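(* Let $X$ be a real Hilbert space, let $S\colon X\rightrightarrows X$ be maximally monotone, let $h\in\mathcal{H}(S)$, let $T\colon X\rightrightarrows X$ be a point-to-set operator, and set $U_S:=\operatorname{int}\operatorname{dom} S$ and $U_T:=\operatorname{int}\operatorname{dom} T$. Let $\theta\colon X\to\left]-\infty,+\infty\right]$ be proper, lower semicontinuous and convex with $U_S\cap\operatorname{dom}\theta\neq\varnothing$, and let $\gamma>0$. Suppose that one of the following holds: (a) $U_S\cap\operatorname{dom}\theta$ is bounded and for all $y\in U_T$, $\mathcal{D}_T^{\flat,h}(\cdot,y)$ is coercive. (b) $\inf\theta(U_S)>-\infty$ and for all $y\in U_T$, $\mathcal{D}_T^{\flat,h}(\cdot,y)$ is coercive. (c) For all $y\in U_T$, $\mathcal{D}_T^{\flat,h}(\cdot,y)$ is supercoercive. Then, for every $y\in U_T$, the function $\theta(\cdot)+\frac{1}{\gamma}\mathcal{D}_T^{\flat,h}(\cdot,y)$ is coercive.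
   Context: $X$ is identified with its dual, and $\langle\cdot,\cdot\rangle$ is the inner product. For a maximally monotone operator $S$ with graph $\mathcal{G}(S)$, a function $h\colon X\times X\to\left]-\infty,+\infty\right]$ represents $S$, written $h\in\mathcal{H}(S)$, if (a) $h$ is convex and (norm $\times$ weak) lower semicontinuous; (b) $h(x,v)\geq\langle x,v\rangle$ for all $(x,v)$; (c) $h(x,v)=\langle x,v\rangle$ if and only if $(x,v)\in\mathcal{G}(S)$. For an operator $A$, $\operatorname{dom} A=\{x: Ax\neq\varnothing\}$; for a function, $\operatorname{dom}\theta=\{x:\theta(x)<\infty\}$. Generalized Bregman distance: for $(x,y)\in\operatorname{dom} S\times\operatorname{dom} T$, $$\mathcal{D}_T^{\flat,h}(x,y):=\inf_{v\in Ty}\big(h(x,v)-\langle x,v\rangle\big),$$ and $\mathcal{D}_T^{\flat,h}(x,y):=+\infty$ if $x\notin\operatorname{dom} S$ or $y\notin\operatorname{dom} T$. A function $g\colon X\to\left]-\infty,+\infty\right]$ is coercive if $\lim_{\|x\|\to\infty}g(x)=\infty$ and supercoercive if $\lim_{\|x\|\to\infty}g(x)/\|x\|=\infty$. *)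

theory Defs
  imports "HOL-Analysis.Analysis"
begin

text \<open>A point-to-set operator on \<open>X\<close> is a function of type \<open>'a \<Rightarrow> 'a set\<close>.\<close>

definition op_dom :: "('a \<Rightarrow> 'b set) \<Rightarrow> 'a set" where
  "op_dom A = {x. A x \<noteq> {}}"

definition op_graph :: "('a \<Rightarrow> 'b set) \<Rightarrow> ('a \<times> 'b) set" where
  "op_graph A = {(x, v). v \<in> A x}"

definition monotone_op :: "('a::real_inner \<Rightarrow> 'a set) \<Rightarrow> bool" where
  "monotone_op A \<longleftrightarrow>
    (\<forall>(x, u) \<in> op_graph A. \<forall>(y, v) \<in> op_graph A. (x - y) \<bullet> (u - v) \<ge> 0)"

definition maximally_monotone :: "('a::real_inner \<Rightarrow> 'a set) \<Rightarrow> bool" where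
  "maximally_monotone A \<longleftrightarrow>
    monotone_op A \<and>
    (\<forall>B. monotone_op B \<and> op_graph A \<subseteq> op_graph B \<longrightarrow> op_graph B = op_graph A)"

text \<open>Functions with values in \<open>]-\<infinity>, +\<infinity>]\<close> are \<^typ>\<open>ereal\<close>-valued functions that satisfy
  \<open>not_minus_infinity\<close>.\<close>

definition not_minus_infinity :: "('a \<Rightarrow> ereal) \<Rightarrow> bool" where
  "not_minus_infinity f \<longleftrightarrow> (\<forall>x. f x \<noteq> - \<infinity>)"

definition fun_dom :: "('a \<Rightarrow> ereal) \<Rightarrow> 'a set" where
  "fun_dom f = {x. f x < \<infinity>}"

definition proper_fun :: "('a \<Rightarrow> ereal) \<Rightarrow> bool" where
  "proper_fun f \<longleftrightarrow> not_minus_infinity f \<and> fun_dom f \<noteq> {}"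

text \<open>Only used for functions without the value \<open>-\<infinity>\<close>, so that the right-hand side never
  contains \<open>\<infinity> - \<infinity>\<close>; the coefficients are strictly positive, so \<open>0 * \<infinity>\<close> does not occur
  either.\<close>

definition convex_fun :: "('a::real_vector \<Rightarrow> ereal) \<Rightarrow> bool" where
  "convex_fun f \<longleftrightarrow>
    (\<forall>x y. \<forall>t::real. 0 < t \<and> t < 1 \<longrightarrow>
      f ((1 - t) *\<^sub>R x + t *\<^sub>R y) \<le> ereal (1 - t) * f x + ereal t * f y)"

definition lsc_fun :: "'a topology \<Rightarrow> ('a \<Rightarrow> ereal) \<Rightarrow> bool" where
  "lsc_fun X f \<longleftrightarrow> (\<forall>c. openin X {x \<in> topspace X. c < f x})"

definition weak_topology :: "'a::real_normed_vector topology" where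
  "weak_topology =
    topology_generated_by {f -` U | (f :: 'a \<Rightarrow> real) U. bounded_linear f \<and> open U}"

definition representatives :: "('a::real_inner \<Rightarrow> 'a set) \<Rightarrow> ('a \<times> 'a \<Rightarrow> ereal) set" where
  "representatives S =
    {h. not_minus_infinity h \<and> convex_fun h \<and>
        lsc_fun (prod_topology euclidean weak_topology) h \<and>
        (\<forall>x v. h (x, v) \<ge> ereal (x \<bullet> v)) \<and>
        (\<forall>x v. h (x, v) = ereal (x \<bullet> v) \<longleftrightarrow> (x, v) \<in> op_graph S)}"

definition bregman_dist ::
  "('a::real_inner \<Rightarrow> 'a set) \<Rightarrow> ('a \<Rightarrow> 'a set) \<Rightarrow> ('a \<times> 'a \<Rightarrow> ereal) \<Rightarrow> 'a \<Rightarrow> 'a \<Rightarrow> ereal" where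
  "bregman_dist S T h x y =
    (if x \<in> op_dom S \<and> y \<in> op_dom T
     then (INF v \<in> T y. h (x, v) - ereal (x \<bullet> v))
     else \<infinity>)"

definition coercive :: "('a::real_normed_vector \<Rightarrow> ereal) \<Rightarrow> bool" where
  "coercive g \<longleftrightarrow> (g \<longlongrightarrow> \<infinity>) at_infinity"

definition supercoercive :: "('a::real_normed_vector \<Rightarrow> ereal) \<Rightarrow> bool" where
  "supercoercive g \<longleftrightarrow> ((\<lambda>x. g x / ereal (norm x)) \<longlongrightarrow> \<infinity>) at_infinity"

end

theory Submission
  imports Defs
begin

text \<open>The hypotheses control \<open>\<theta>\<close> only on \<open>U\<^sub>S\<close>, whereas the distance may be
  finite at any point of \<open>dom S\<close>. The
  gap is closed by showing that the half-open segment from an interior point of \<open>dom S\<close> to any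
  point \<open>x\<close> of \<open>dom S\<close> stays in \<open>U\<^sub>S\<close>; convexity of \<open>\<theta>\<close> along that segment then carries lower bounds of
  \<open>\<theta>\<close> and bounds on its domain over to \<open>x\<close>. For the segment property, let \<open>C\<close> be the projection of
  \<open>dom h\<close> to the first factor, a convex set containing \<open>dom S\<close>; it suffices that every interior point
  \<open>w\<close> of \<open>C\<close> lies in \<open>dom S\<close>. Minty's theorem (minimise \<open>h(x, v) + \<parallel>(x, v)\<parallel>\<^sup>2 / 2\<close>) yields resolvent
  points \<open>x\<^sub>n + \<mu>\<^sub>n u\<^sub>n = w\<close> with \<open>u\<^sub>n \<in> S x\<^sub>n\<close> and \<open>\<mu>\<^sub>n \<rightarrow> 0\<close>. The Fitzpatrick inequality and
  Baire's theorem bound the \<open>u\<^sub>n\<close>, and monotonicity makes them Cauchy, so \<open>S w\<close> contains their limit.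
  In case (c), \<open>\<theta>\<close> decreases at most linearly.\<close>

section \<open>Epigraphs, and lower semicontinuity in the norm and weak topologies\<close>

lemma closed_epigraph:
  fixes f :: "'a::topological_space \<Rightarrow> ereal"
  assumes "lsc_fun euclidean f"
  shows "closed {(p, r). f p \<le> ereal r}"
proof -
  have "\<exists>T. open T \<and> z \<in> T \<and> T \<subseteq> - {(p, r). f p \<le> ereal r}"
    if z: "z \<in> - {(p, r). f p \<le> ereal r}" for z
  proof -
    obtain p r where [simp]: "z = (p, r)" by (cases z)
    have "ereal r < f p" using z by auto
    \<comment> \<open>A real \<open>q\<close> strictly between \<open>r\<close> and
      \<open>f p\<close> gives an open box around the point, the superlevel set at \<open>q\<close>
      times the reals below \<open>q\<close>, that misses the epigraph.\<close>
    then obtain q where q: "ereal r < ereal q" "ereal q < f p"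
      using ereal_dense2 by blast
    have "open {x. ereal q < f x}"
      using assms by (simp add: lsc_fun_def)
    then have "open ({x. ereal q < f x} \<times> {..<q})"
      by (intro open_Times) auto
    moreover have "({x. ereal q < f x} \<times> {..<q}) \<subseteq> - {(p, r). f p \<le> ereal r}"
    proof clarsimp
      fix a b assume "ereal q < f a" "b < q" "f a \<le> ereal b"
      then have "ereal q < ereal b" using order.strict_trans2 by blast
      then show False using \<open>b < q\<close> by simp
    qed
    ultimately show ?thesis using q by (intro exI[of _ "{x. ereal q < f x} \<times> {..<q}"]) auto
  qed
  then show ?thesis unfolding closed_def open_subopen[of "- _"] by blast
qed

lemma convex_epigraph:
  assumes "convex_fun f"
  shows "convex {(p, r). f p \<le> ereal r}"
  unfolding convex_alt
proof clarsimp
  fix p q r s and t :: real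
  assume fp: "f p \<le> ereal r" and fq: "f q \<le> ereal s" and t: "0 \<le> t" "t \<le> 1"
  show "f ((1 - t) *\<^sub>R p + t *\<^sub>R q) \<le> ereal ((1 - t) * r + t * s)"
  \<comment> \<open>\<open>convex_fun\<close> speaks of \<open>0 < t < 1\<close> only, so the
    endpoints are treated apart.\<close>
  proof (cases "t = 0 \<or> t = 1")
    case True then show ?thesis using fp fq by auto
  next
    case False
    then have "f ((1 - t) *\<^sub>R p + t *\<^sub>R q) \<le> ereal (1 - t) * f p + ereal t * f q"
      using assms t by (simp add: convex_fun_def)
    also have "\<dots> \<le> ereal (1 - t) * ereal r + ereal t * ereal s"
      using t fp fq by (intro add_mono ereal_mult_left_mono) auto
    finally show ?thesis by simp
  qed
qed

lemma openin_weak_topology_imp_open: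
  assumes "openin weak_topology U"
  shows "open U"
proof (rule generate_topology_on_coarsest)
  show "istopology open"
    by (auto simp: istopology_def)
  show "generate_topology_on {f -` U |f U. bounded_linear (f :: 'a \<Rightarrow> real) \<and> open U} U"
    using assms unfolding weak_topology_def by (rule openin_topology_generated_by)
next
  fix S
  assume "S \<in> {f -` U |f U. bounded_linear (f :: 'a \<Rightarrow> real) \<and> open U}"
  then obtain f :: "'a \<Rightarrow> real" and V where "S = f -` V" "bounded_linear f" "open V"
    by auto
  then show "open S"
    using linear_continuous_on[of f UNIV] by (auto simp: continuous_on_open_vimage)
qed

lemma topspace_weak_topology [simp]:
  "topspace (weak_topology :: 'a::real_normed_vector topology) = UNIV"
proof -
  have "UNIV \<in> {f -` U |(f :: 'a \<Rightarrow> real) U. bounded_linear f \<and> open U}"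
    by clarsimp (metis bounded_linear_zero open_UNIV vimage_UNIV)
  then show ?thesis
    unfolding weak_topology_def topology_generated_by_topspace by blast
qed

text \<open>Weakly open sets are norm open, so a box witnessing openness in the mixed topology also
  does so in the norm topology. This is what makes the epigraph of a representative norm
  closed.\<close>

lemma lsc_fun_norm_weak_imp_norm:
  fixes h :: "'a::topological_space \<times> 'b::real_normed_vector \<Rightarrow> ereal"
  assumes "lsc_fun (prod_topology euclidean weak_topology) h"
  shows "lsc_fun euclidean h"
  unfolding lsc_fun_def
proof
  fix c
  have "openin (prod_topology euclidean weak_topology) {x. c < h x}"
    using assms by (simp add: lsc_fun_def)
  then have *: "\<exists>U V. open U \<and> openin weak_topology V \<and> x \<in> U \<and> y \<in> V \<and> U \<times> V \<subseteq> {x. c < h x}"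
    if "(x, y) \<in> {x. c < h x}" for x y
    using that unfolding openin_prod_topology_alt by (auto simp only: open_openin)
  have "open {x. c < h x}"
    by (rule open_prod_intro) (metis * mem_Times_iff openin_weak_topology_imp_open surj_pair fst_conv snd_conv)
  then show "openin euclidean {x \<in> topspace euclidean. c < h x}"
    by simp
qed

section \<open>Quadratic regularization and a Baire argument in complete spaces\<close>

text \<open>Adding half the squared norm makes the functional strongly convex: evaluating it at
  midpoints shows that a minimizing sequence is Cauchy. The conclusion is first-order optimality,
  that is, \<open>- p0\<close> is a subgradient at the minimizer \<open>p0\<close> of the function
  with epigraph \<open>E\<close>.\<close>

lemma exists_minimizer_regularized:
  fixes E :: "('a::{real_inner, complete_space} \<times> real) set"
  assumes "closed E" "convex E" "E \<noteq> {}"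
    and bound: "\<And>p r. (p, r) \<in> E \<Longrightarrow> b \<le> r + (p \<bullet> p) / 2"
  obtains p0 r0 where "(p0, r0) \<in> E"
    and "\<And>p r. (p, r) \<in> E \<Longrightarrow> r0 - p0 \<bullet> (p - p0) \<le> r"
proof -
  define f where "f = (\<lambda>e::'a \<times> real. snd e + (fst e \<bullet> fst e) / 2)"
  define m where "m = Inf (f ` E)"
  have bdd: "bdd_below (f ` E)"
    using bound by (intro bdd_belowI[of _ b]) (auto simp: f_def)
  have m: "m \<le> f e" if "e \<in> E" for e
    unfolding m_def using bdd that by (intro cInf_lower) auto
  have "\<exists>e\<in>E. f e < m + 1 / real (Suc n)" for n
    using cInf_lessD[of "f ` E" "m + 1 / real (Suc n)"] \<open>E \<noteq> {}\<close> unfolding m_def by auto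
  then obtain e where e: "\<And>n. e n \<in> E" "\<And>n. f (e n) < m + 1 / real (Suc n)"
    by metis
  define p where "p = fst \<circ> e"
  define r where "r = snd \<circ> e"
  have mid: "(norm (p i - p j))\<^sup>2 \<le> 4 * (1 / real (Suc i) + 1 / real (Suc j))" for i j
  proof -
    have "(1/2) *\<^sub>R e i + (1/2) *\<^sub>R e j \<in> E"
      using \<open>convex E\<close> e by (auto simp: convex_def)
    then have "m \<le> f ((1/2) *\<^sub>R e i + (1/2) *\<^sub>R e j)" by (rule m)
    also have "\<dots> = (f (e i) + f (e j)) / 2 - (norm (p i - p j))\<^sup>2 / 8"
      by (simp add: f_def p_def power2_norm_eq_inner inner_simps inner_commute field_simps)
    finally show ?thesis using e(2)[of i] e(2)[of j] by argo
  qed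
  have "Cauchy p"
  proof (rule metric_CauchyI)
    fix d :: real assume "d > 0"
    then obtain N where N: "8 / d\<^sup>2 < real N" using reals_Archimedean2 by blast
    have "dist (p i) (p j) < d" if "i \<ge> N" "j \<ge> N" for i j
    proof -
      have "1 / real (Suc k) < d\<^sup>2 / 8" if "k \<ge> N" for k
      proof -
        have "8 / d\<^sup>2 < real (Suc k)" using N that by linarith
        then show ?thesis using \<open>d > 0\<close> by (simp add: field_simps)
      qed
      from this[OF that(1)] this[OF that(2)] have "(norm (p i - p j))\<^sup>2 < d\<^sup>2"
        using mid[of i j] by argo
      then show ?thesis using \<open>d > 0\<close> power_less_imp_less_base by (fastforce simp: dist_norm)
    qed
    then show "\<exists>M. \<forall>i\<ge>M. \<forall>j\<ge>M. dist (p i) (p j) < d" by blast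
  qed
  then obtain p0 where p0: "p \<longlonglongrightarrow> p0"
    using Cauchy_convergent convergent_def by blast
  \<comment> \<open>The value with \<open>f (p0, r0) = m\<close>; the heights \<open>r n\<close>
    converge to it because \<open>f (e n)\<close> and \<open>p n\<close> converge.\<close>
  define r0 where "r0 = m - (p0 \<bullet> p0) / 2"
  have inv0: "(\<lambda>n. 1 / real (Suc n)) \<longlonglongrightarrow> 0"
    using LIMSEQ_inverse_real_of_nat by (simp add: inverse_eq_divide)
  have "(\<lambda>n. f (e n)) \<longlonglongrightarrow> m"
  proof (rule tendsto_sandwich)
    show "\<forall>\<^sub>F n in sequentially. m \<le> f (e n)"
      using m e by auto
    show "\<forall>\<^sub>F n in sequentially. f (e n) \<le> m + 1 / real (Suc n)"
      using e(2) less_imp_le by (intro always_eventually) blast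
    show "(\<lambda>n. m + 1 / real (Suc n)) \<longlonglongrightarrow> m"
      using tendsto_add[OF tendsto_const inv0, of m] by simp
  qed auto
  then have "(\<lambda>n. f (e n) - (p n \<bullet> p n) / 2) \<longlonglongrightarrow> r0"
    unfolding r0_def by (intro tendsto_intros p0) auto
  then have "r \<longlonglongrightarrow> r0"
    by (simp add: f_def p_def r_def o_def)
  then have "(\<lambda>n. (p n, r n)) \<longlonglongrightarrow> (p0, r0)"
    using p0 by (intro tendsto_Pair)
  moreover have "\<forall>n. (p n, r n) \<in> E"
    using e by (simp add: p_def r_def)
  ultimately have E0: "(p0, r0) \<in> E"
    using closed_sequentially[OF \<open>closed E\<close>, of "\<lambda>n. (p n, r n)"] by simp
  moreover have "r0 - p0 \<bullet> (p - p0) \<le> r" if pr: "(p, r) \<in> E" for p r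
  proof (rule ccontr)
    assume neg: "\<not> ?thesis"
    \<comment> \<open>If the inequality fails by \<open>a > 0\<close>, moving by \<open>t\<close>
      towards \<open>(p, r)\<close> changes \<open>f\<close> by
      \<open>- t * a + t\<^sup>2 * c / 2\<close>, which is negative for \<open>t\<close> at most
      \<open>a / (c + 1)\<close>. The \<open>+ 1\<close> keeps the denominator positive when
      \<open>p = p0\<close>.\<close>
    define a where "a = r0 - r - p0 \<bullet> (p - p0)"
    define c where "c = (p - p0) \<bullet> (p - p0)"
    define t where "t = min 1 (a / (c + 1))"
    have "a > 0" "c \<ge> 0" using neg by (auto simp: a_def c_def)
    then have t: "0 < t" "t \<le> 1" "t \<le> a / (c + 1)" by (auto simp: t_def)
    then have "t * (c + 1) \<le> a" using \<open>c \<ge> 0\<close> by (simp add: pos_le_divide_eq)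
    have "(1 - t) *\<^sub>R (p0, r0) + t *\<^sub>R (p, r) \<in> E"
      using \<open>convex E\<close> E0 pr t by (intro convexD_alt) auto
    then have "m \<le> f ((1 - t) *\<^sub>R (p0, r0) + t *\<^sub>R (p, r))" by (rule m)
    also have "\<dots> = m - t * a + t\<^sup>2 * c / 2"
      by (simp add: f_def a_def c_def r0_def inner_simps inner_commute field_simps power2_eq_square)
    finally have "t * a \<le> t * (t * c / 2)" by (simp add: power2_eq_square)
    then have "a \<le> t * c / 2" using t by simp
    moreover have "0 \<le> t * c" using t \<open>c \<ge> 0\<close> by simp
    ultimately show False using t \<open>t * (c + 1) \<le> a\<close> by (simp add: distrib_left)
  qed
  ultimately show ?thesis by (rule that)
qed

text \<open>Baire's theorem gives a ball in some \<open>C n\<close>, but around an unknown centre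
  \<open>c\<close>. A point \<open>c'\<close> beyond \<open>w\<close>, on the side opposite to
  \<open>c\<close>, also lies in some \<open>C k\<close>; convex combinations of \<open>c'\<close>
  with the ball around \<open>c\<close> then fill a ball around \<open>w\<close>.\<close>

lemma convex_cover_ball_imp_ball:
  fixes C :: "nat \<Rightarrow> 'a::{real_normed_vector, complete_space} set"
  assumes C: "\<And>n. closed (C n)" "\<And>n. convex (C n)" "incseq C"
    and cover: "ball w \<epsilon> \<subseteq> (\<Union>n. C n)" and "\<epsilon> > 0"
  obtains n \<delta> where "\<delta> > 0" "ball w \<delta> \<subseteq> C n"
proof -
  have "\<exists>n. interior (C n) \<noteq> {}"
  proof (rule ccontr)
    assume "\<not> ?thesis"
    then have "euclidean interior_of \<Union>(range C) = {}"
      using C(1) completely_metrizable_space_euclidean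
      by (intro Baire_category_alt) auto
    moreover have "w \<in> interior (\<Union>(range C))"
      using cover \<open>\<epsilon> > 0\<close> by (auto simp: mem_interior)
    ultimately show False by simp
  qed
  then obtain n c where "c \<in> interior (C n)" by blast
  then obtain \<rho> where \<rho>: "\<rho> > 0" "ball c \<rho> \<subseteq> C n" by (meson mem_interior)
  define t where "t = \<epsilon> / (2 * (norm (w - c) + 1))"
  have t: "t > 0" using \<open>\<epsilon> > 0\<close> by (simp add: t_def add_nonneg_pos)
  define c' where "c' = w + t *\<^sub>R (w - c)"
  have "t * norm (w - c) < \<epsilon>"
    using \<open>\<epsilon> > 0\<close> unfolding t_def by (simp add: field_simps add_pos_nonneg)
  then have "c' \<in> ball w \<epsilon>"
    using t by (simp add: c'_def dist_norm)
  then obtain k where "c' \<in> C k" using cover by auto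
  define N where "N = max n k"
  have c': "c' \<in> C N" and bN: "ball c \<rho> \<subseteq> C N"
    using \<open>c' \<in> C k\<close> \<rho>(2) \<open>incseq C\<close>[unfolded incseq_def] unfolding N_def
    by (meson max.cobounded1 max.cobounded2 subset_iff)+
  \<comment> \<open>The weight for which
    \<open>w = (1 - s) *\<^sub>R c' + s *\<^sub>R c\<close>.\<close>
  define s where "s = t / (1 + t)"
  have s: "0 < s" "s < 1" "(1 - s) * t = s" using t by (auto simp: s_def field_simps)
  have "ball w (s * \<rho>) \<subseteq> C N"
  proof
    fix x assume x: "x \<in> ball w (s * \<rho>)"
    define d where "d = c + (1 / s) *\<^sub>R (x - w)"
    have "d \<in> ball c \<rho>"
      using x s by (simp add: d_def dist_norm norm_minus_commute pos_divide_less_eq mult.commute)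
    then have "d \<in> C N" using bN by blast
    then have "(1 - s) *\<^sub>R c' + s *\<^sub>R d \<in> C N"
      using C(2)[of N] c' s by (simp add: convex_alt)
    also have "(1 - s) *\<^sub>R c' + s *\<^sub>R d = (1 - s) *\<^sub>R w + ((1 - s) * t) *\<^sub>R (w - c) + s *\<^sub>R c + (x - w)"
      using s(1) by (simp add: c'_def d_def algebra_simps)
    also have "\<dots> = x"
      unfolding s(3) by (simp add: algebra_simps)
    finally show "x \<in> C N" .
  qed
  then show ?thesis using that[of "s * \<rho>" N] s \<rho> by simp
qed

text \<open>\<open>G\<close> is the graph of the operator and \<open>E\<close> the epigraph of its representative; working with the
  epigraph avoids extended real arithmetic.\<close>

locale represented_operator =
  fixes G :: "('a::{real_inner, complete_space} \<times> 'a) set"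
    and E :: "(('a \<times> 'a) \<times> real) set"
  assumes monotone: "(x, u) \<in> G \<Longrightarrow> (y, v) \<in> G \<Longrightarrow> 0 \<le> (x - y) \<bullet> (u - v)"
    and maximal: "(\<And>y u. (y, u) \<in> G \<Longrightarrow> 0 \<le> (x - y) \<bullet> (v - u)) \<Longrightarrow> (x, v) \<in> G"
    and closed_E: "closed E"
    and convex_E: "convex E"
    and inner_le: "((x, v), r) \<in> E \<Longrightarrow> x \<bullet> v \<le> r"
    and graph_in_E: "(x, v) \<in> G \<Longrightarrow> ((x, v), x \<bullet> v) \<in> E"
begin

section \<open>The Fitzpatrick inequality and Minty's theorem\<close>

text \<open>If \<open>E\<close> were empty, so would be \<open>G\<close>, and then every pair would
  satisfy the premise of \<open>maximal\<close> vacuously.\<close>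

lemma E_nonempty: "E \<noteq> {}"
  using graph_in_E maximal by (metis empty_iff)

text \<open>The Fitzpatrick function is a lower bound of every representative: apply
  \<open>inner_le\<close> on the segment from the given point of \<open>E\<close> to a graph point,
  cancel \<open>1 - t\<close>, and let \<open>t\<close> tend to 1.\<close>

lemma fitzpatrick_le:
  assumes E: "((x, v), r) \<in> E" and G: "(y, u) \<in> G"
  shows "x \<bullet> u + y \<bullet> v - y \<bullet> u \<le> r"
proof (rule tendsto_upperbound)
  define \<phi> where "\<phi> = (\<lambda>t. (1 - t) * (x \<bullet> v) + t * (x \<bullet> u + y \<bullet> v - y \<bullet> u))"
  show "(\<phi> \<longlongrightarrow> x \<bullet> u + y \<bullet> v - y \<bullet> u) (at_left 1)"
    unfolding \<phi>_def by (rule tendsto_eq_intros refl | simp)+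
  have "\<phi> t \<le> r" if t: "0 < t" "t < 1" for t
  proof -
    have "(1 - t) *\<^sub>R ((x, v), r) + t *\<^sub>R ((y, u), y \<bullet> u) \<in> E"
      using convex_E E graph_in_E[OF G] t by (intro convexD_alt) auto
    then have "(((1 - t) *\<^sub>R x + t *\<^sub>R y, (1 - t) *\<^sub>R v + t *\<^sub>R u), (1 - t) * r + t * (y \<bullet> u)) \<in> E"
      by simp
    from inner_le[OF this] have "(1 - t) * \<phi> t \<le> (1 - t) * r"
      by (simp add: \<phi>_def inner_simps inner_commute algebra_simps)
    then show ?thesis using t by simp
  qed
  then show "\<forall>\<^sub>F t in at_left 1. \<phi> t \<le> r"
    using eventually_at_left_real[of 0 1] by (auto elim: eventually_mono)
qed auto

text \<open>The regularized functional is nonnegative, as the inner product of \<open>x\<close> and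
  \<open>v\<close> plus half the squared norm of \<open>(x, v)\<close> equals half the squared norm
  of \<open>x + v\<close>. Optimality of the minimizer \<open>(x0, v0)\<close> shows that
  \<open>(- v0, - x0)\<close> is monotonically related to \<open>G\<close>.\<close>

lemma zero_in_range_id_plus: "\<exists>x. (x, - x) \<in> G"
proof -
  have sq: "x \<bullet> v + ((x, v) \<bullet> (x, v)) / 2 = (norm (x + v))\<^sup>2 / 2" for x v :: 'a
    by (simp add: power2_norm_eq_inner inner_simps inner_commute field_simps)
  have "0 \<le> r + (p \<bullet> p) / 2" if "(p, r) \<in> E" for p r
  proof -
    have "fst p \<bullet> snd p \<le> r" using that by (intro inner_le) simp
    moreover have "fst p \<bullet> snd p + (p \<bullet> p) / 2 = (norm (fst p + snd p))\<^sup>2 / 2"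
      using sq[of "fst p" "snd p"] by simp
    moreover have "0 \<le> (norm (fst p + snd p))\<^sup>2" by simp
    ultimately show ?thesis by linarith
  qed
  then obtain p0 r0 where "(p0, r0) \<in> E"
    and opt: "\<And>p r. (p, r) \<in> E \<Longrightarrow> r0 - p0 \<bullet> (p - p0) \<le> r"
    using exists_minimizer_regularized[OF closed_E convex_E E_nonempty] by blast
  then obtain x0 v0 where p0: "p0 = (x0, v0)" by (cases p0)
  have r0: "x0 \<bullet> v0 \<le> r0"
    using inner_le \<open>(p0, r0) \<in> E\<close> p0 by blast
  have *: "(norm (x0 + v0))\<^sup>2 \<le> (- v0 - y) \<bullet> (- x0 - u)" if G: "(y, u) \<in> G" for y u
  proof -
    have "r0 - (x0 \<bullet> (y - x0) + v0 \<bullet> (u - v0)) \<le> y \<bullet> u"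
      using opt[OF graph_in_E[OF G]] by (simp add: p0)
    then show ?thesis
      using r0 by (simp add: power2_norm_eq_inner inner_simps inner_commute algebra_simps)
  qed
  have "(- v0, - x0) \<in> G"
    using order_trans[OF zero_le_power2 *] by (rule maximal)
  \<comment> \<open>Testing \<open>*\<close> at the new graph point itself makes its right-hand side
    vanish.\<close>
  moreover from *[OF this] have "x0 = - v0" by (simp add: eq_neg_iff_add_eq_0)
  ultimately show ?thesis by (metis minus_minus)
qed

text \<open>Reduction to the previous lemma: \<open>G'\<close> is the graph of \<mu> times the
  operator translated by \<open>w\<close>, and the affine map \<open>\<Phi>\<close> pulls
  \<open>E\<close> back to the epigraph of a matching representative. A pair \<open>(x, - x)\<close>
  in \<open>G'\<close> is a resolvent point after translation back.\<close>

lemma resolvent_exists: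
  assumes "\<mu> > 0"
  shows "\<exists>x u. (x, u) \<in> G \<and> x + \<mu> *\<^sub>R u = w"
proof -
  define G' where "G' = {(x, v). (x + w, (1 / \<mu>) *\<^sub>R v) \<in> G}"
  define \<Phi> where "\<Phi> = (\<lambda>((x, v), r). ((x + w, (1 / \<mu>) *\<^sub>R v), (r + w \<bullet> v) / \<mu>))"
  have \<Phi>: "\<Phi> ((x, v), r) = ((x + w, (1 / \<mu>) *\<^sub>R v), (r + w \<bullet> v) / \<mu>)" for x v r
    by (simp add: \<Phi>_def)
  interpret scaled: represented_operator G' "\<Phi> -` E"
  proof
    fix x u y v assume "(x, u) \<in> G'" "(y, v) \<in> G'"
    then have "0 \<le> (x + w - (y + w)) \<bullet> ((1 / \<mu>) *\<^sub>R u - (1 / \<mu>) *\<^sub>R v)"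
      by (intro monotone) (auto simp: G'_def)
    also have "\<dots> = ((x - y) \<bullet> (u - v)) / \<mu>"
      by (simp flip: scaleR_diff_right)
    finally show "0 \<le> (x - y) \<bullet> (u - v)"
      using assms by (simp add: zero_le_divide_iff)
  next
    fix x v assume *: "\<And>y u. (y, u) \<in> G' \<Longrightarrow> 0 \<le> (x - y) \<bullet> (v - u)"
    have "(x + w, (1 / \<mu>) *\<^sub>R v) \<in> G"
    proof (rule maximal)
      fix y u assume "(y, u) \<in> G"
      then have "(y - w, \<mu> *\<^sub>R u) \<in> G'" using assms by (simp add: G'_def)
      from *[OF this] have "0 \<le> (x + w - y) \<bullet> (v - \<mu> *\<^sub>R u)"
        by (simp add: algebra_simps)
      also have "v - \<mu> *\<^sub>R u = \<mu> *\<^sub>R ((1 / \<mu>) *\<^sub>R v - u)"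
        using assms by (simp add: algebra_simps)
      finally show "0 \<le> (x + w - y) \<bullet> ((1 / \<mu>) *\<^sub>R v - u)"
        using assms by (simp add: zero_le_mult_iff)
    qed
    then show "(x, v) \<in> G'" by (simp add: G'_def)
  next
    have "continuous_on UNIV \<Phi>"
      unfolding \<Phi>_def case_prod_beta using assms by (intro continuous_intros) auto
    then show "closed (\<Phi> -` E)"
      using closed_E by (simp add: continuous_on_closed_vimage)
  next
    have aff: "\<Phi> ((1 - t) *\<^sub>R a + t *\<^sub>R b) = (1 - t) *\<^sub>R \<Phi> a + t *\<^sub>R \<Phi> b" for a b t
      using assms by (cases a; cases b) (auto simp: \<Phi>_def inner_simps field_simps algebra_simps)
    show "convex (\<Phi> -` E)"
      using convex_E unfolding convex_alt by (simp add: aff)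
  next
    fix x v r assume "((x, v), r) \<in> \<Phi> -` E"
    then have "(x + w) \<bullet> ((1 / \<mu>) *\<^sub>R v) \<le> (r + w \<bullet> v) / \<mu>"
      by (intro inner_le) (simp add: \<Phi>)
    then show "x \<bullet> v \<le> r"
      using assms by (simp add: inner_simps field_simps)
  next
    fix x v assume "(x, v) \<in> G'"
    then have "((x + w, (1 / \<mu>) *\<^sub>R v), (x + w) \<bullet> ((1 / \<mu>) *\<^sub>R v)) \<in> E"
      by (intro graph_in_E) (simp add: G'_def)
    then show "((x, v), x \<bullet> v) \<in> \<Phi> -` E"
      by (simp add: \<Phi> inner_simps add_divide_distrib)
  qed
  obtain x where "(x, - x) \<in> G'" using scaled.zero_in_range_id_plus by blast
  then have "(x + w, (1 / \<mu>) *\<^sub>R (- x)) \<in> G" by (simp add: G'_def)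
  moreover have "(x + w) + \<mu> *\<^sub>R ((1 / \<mu>) *\<^sub>R (- x)) = w" using assms by simp
  ultimately show ?thesis by blast
qed

section \<open>Bounded resolvent sequences and the interior of the domain\<close>

lemma graph_closed:
  assumes "\<And>n. (x n, u n) \<in> G" "x \<longlonglongrightarrow> w" "u \<longlonglongrightarrow> v"
  shows "(w, v) \<in> G"
proof (rule maximal)
  fix y a assume "(y, a) \<in> G"
  then have "\<And>n. 0 \<le> (x n - y) \<bullet> (u n - a)" using assms(1) monotone by blast
  moreover have "(\<lambda>n. (x n - y) \<bullet> (u n - a)) \<longlonglongrightarrow> (w - y) \<bullet> (v - a)"
    by (intro tendsto_intros assms)
  ultimately show "0 \<le> (w - y) \<bullet> (v - a)"
    by (intro tendsto_lowerbound) auto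
qed

text \<open>Monotonicity at two resolvent points bounds the increments of \<open>u n\<close> by those of the
  squared norm of \<open>u n\<close>, which is therefore monotone.\<close>

lemma bounded_yosida_imp_mem_domain:
  assumes G: "\<And>n. (x n, u n) \<in> G" and w: "\<And>n. x n + \<mu> n *\<^sub>R u n = w"
    and pos: "\<And>n. \<mu> n > 0" and dec: "decseq \<mu>" and lim: "\<mu> \<longlonglongrightarrow> 0"
    and bd: "\<And>n. norm (u n) \<le> B"
  shows "w \<in> fst ` G"
proof -
  have incr: "(norm (u i - u j))\<^sup>2 \<le> (norm (u j))\<^sup>2 - (norm (u i))\<^sup>2" if "i \<le> j" for i j
  proof -
    have x: "x k = w - \<mu> k *\<^sub>R u k" for k
      using w[of k] by (simp add: algebra_simps)
    have "0 \<le> (x i - x j) \<bullet> (u i - u j)" using monotone G by blast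
    \<comment> \<open>Here \<open>x i - x j = \<mu> j *\<^sub>R u j - \<mu> i *\<^sub>R u i\<close>;
      its inner product with \<open>u i - u j\<close> is rewritten by polarization.\<close>
    then have key: "(\<mu> i + \<mu> j) * (norm (u i - u j))\<^sup>2
        \<le> (\<mu> i - \<mu> j) * ((norm (u j))\<^sup>2 - (norm (u i))\<^sup>2)"
      unfolding x by (simp add: power2_norm_eq_inner inner_simps inner_commute algebra_simps)
    define N where "N = (norm (u i - u j))\<^sup>2"
    define D where "D = (norm (u j))\<^sup>2 - (norm (u i))\<^sup>2"
    have N: "N \<ge> 0" by (simp add: N_def)
    have le: "\<mu> j \<le> \<mu> i" using dec that by (simp add: decseq_def)
    have k: "(\<mu> i + \<mu> j) * N \<le> (\<mu> i - \<mu> j) * D" using key by (simp add: N_def D_def)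
    show ?thesis unfolding N_def[symmetric] D_def[symmetric]
    proof (cases "\<mu> i = \<mu> j")
      \<comment> \<open>With equal parameters nothing can be divided by
        \<open>\<mu> i - \<mu> j\<close>, but the inequality forces
        \<open>u i = u j\<close>.\<close>
      case True
      then have "u i = u j"
        using k N pos[of j] by (simp add: N_def mult_le_0_iff)
      then show "N \<le> D" by (simp add: N_def D_def)
    next
      case False
      then have p: "0 < \<mu> i - \<mu> j" using le by simp
      have "(\<mu> i - \<mu> j) * N \<le> (\<mu> i + \<mu> j) * N"
        using N pos[of j] by (intro mult_right_mono) auto
      then have "(\<mu> i - \<mu> j) * N \<le> (\<mu> i - \<mu> j) * D" using k by linarith
      then show "N \<le> D" using p by simp
    qed
  qed
  define \<nu> where "\<nu> = (\<lambda>n. (norm (u n))\<^sup>2)"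
  have "incseq \<nu>"
    unfolding incseq_def \<nu>_def using incr by (smt (verit) zero_le_power2)
  moreover have "\<nu> n \<le> B\<^sup>2" for n
    using bd by (simp add: \<nu>_def power_mono)
  ultimately have "Cauchy \<nu>"
    by (metis incseq_convergent convergent_def LIMSEQ_imp_Cauchy)
  have "Cauchy u"
  proof (rule metric_CauchyI)
    fix d :: real assume "d > 0"
    then obtain N where N: "\<And>i j. i \<ge> N \<Longrightarrow> j \<ge> N \<Longrightarrow> dist (\<nu> i) (\<nu> j) < d\<^sup>2"
      using \<open>Cauchy \<nu>\<close> unfolding Cauchy_def by (metis zero_less_power)
    have le: "dist (u i) (u j) < d" if "N \<le> i" "i \<le> j" for i j
    proof -
      have "(dist (u i) (u j))\<^sup>2 < d\<^sup>2"
        using incr[OF that(2)] N[of i j] that unfolding \<nu>_def dist_norm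
        by (simp add: abs_real_def split: if_splits)
      then show ?thesis using \<open>d > 0\<close> by (simp add: power_less_imp_less_base)
    qed
    then have "dist (u i) (u j) < d" if "N \<le> i" "N \<le> j" for i j
      using le[of i j] le[of j i] that by (cases "i \<le> j") (auto simp: dist_commute)
    then show "\<exists>M. \<forall>i\<ge>M. \<forall>j\<ge>M. dist (u i) (u j) < d" by blast
  qed
  then obtain v where v: "u \<longlonglongrightarrow> v"
    using Cauchy_convergent convergent_def by blast
  have "(\<lambda>n. w - \<mu> n *\<^sub>R u n) \<longlonglongrightarrow> w - 0 *\<^sub>R v"
    by (intro tendsto_intros v lim)
  moreover have "(\<lambda>n. w - \<mu> n *\<^sub>R u n) = x"
    using w by (intro ext) (metis add_diff_cancel_right')
  ultimately have "(w, v) \<in> G"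
    using graph_closed[OF G _ v] by simp
  then show ?thesis by force
qed

text \<open>The sets \<open>C n\<close> are intersections of closed half-spaces. By the Fitzpatrick
  inequality they cover a ball around \<open>w\<close>; the weight \<open>1 + norm y\<close> absorbs
  the term \<open>y \<bullet> v\<close>, where \<open>v\<close> depends on \<open>x\<close> alone.
  The Baire argument then makes the bound uniform near \<open>w\<close>.\<close>

lemma locally_bounded:
  assumes "w \<in> interior (fst ` fst ` E)"
  obtains \<epsilon> and M :: real where "\<epsilon> > 0" "M \<ge> 0"
    "\<And>x y u. x \<in> ball w \<epsilon> \<Longrightarrow> (y, u) \<in> G \<Longrightarrow> (x - y) \<bullet> u \<le> M * (1 + norm y)"
proof -
  define C where "C = (\<lambda>n::nat. \<Inter>(y, u)\<in>G. {x. (x - y) \<bullet> u \<le> real n * (1 + norm y)})"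
  have half: "{x. (x - y) \<bullet> u \<le> k} = {x. u \<bullet> x \<le> k + u \<bullet> y}" for y u :: 'a and k
    by (auto simp: inner_simps inner_commute)
  have 1: "closed (C n)" for n
    unfolding C_def half by (intro closed_INT) (auto simp: closed_halfspace_le)
  have 2: "convex (C n)" for n
    unfolding C_def half by (intro convex_INT) (auto simp: convex_halfspace_le)
  have 3: "incseq C"
  proof (rule incseq_SucI)
    fix n
    have "real n * (1 + norm y) \<le> real (Suc n) * (1 + norm y)" for y :: 'a
      by (intro mult_right_mono) auto
    then show "C n \<le> C (Suc n)"
      unfolding C_def by (fastforce intro: order_trans)
  qed
  obtain \<rho> where \<rho>: "\<rho> > 0" "ball w \<rho> \<subseteq> fst ` fst ` E" using assms mem_interior by blast
  have 4: "ball w \<rho> \<subseteq> (\<Union>n. C n)"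
  proof
    fix x assume "x \<in> ball w \<rho>"
    then obtain v r where E: "((x, v), r) \<in> E" using \<rho> by force
    obtain n where n: "max \<bar>r\<bar> (norm v) \<le> real n" using real_arch_simple by blast
    have "(x - y) \<bullet> u \<le> real n * (1 + norm y)" if "(y, u) \<in> G" for y u
    proof -
      have "(x - y) \<bullet> u \<le> r - y \<bullet> v"
        using fitzpatrick_le[OF E that] by (simp add: inner_simps)
      also have "\<dots> \<le> \<bar>r\<bar> + norm y * norm v"
        using Cauchy_Schwarz_ineq2[of y v] by linarith
      also have "\<dots> \<le> real n + norm y * real n"
        using n by (intro add_mono mult_left_mono) auto
      finally show ?thesis by (simp add: algebra_simps)
    qed
    then show "x \<in> (\<Union>n. C n)" by (auto simp: C_def)
  qed
  obtain n \<delta> where "\<delta> > 0" "ball w \<delta> \<subseteq> C n"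
    using convex_cover_ball_imp_ball[OF 1 2 3 4 \<rho>(1)] by blast
  then show ?thesis
    by (intro that[of \<delta> "real n"]) (force simp: C_def)+
qed

text \<open>Resolvent points for parameters tending to 0 have bounded \<open>u n\<close>: the local
  bound at a point displaced from \<open>w\<close> along \<open>u n\<close> controls the norm of
  \<open>u n\<close>.\<close>

lemma interior_domain_representative:
  assumes "w \<in> interior (fst ` fst ` E)"
  shows "w \<in> fst ` G"
proof -
  obtain \<epsilon> M where \<epsilon>: "\<epsilon> > 0" and M: "M \<ge> 0"
    and bd: "\<And>x y u. x \<in> ball w \<epsilon> \<Longrightarrow> (y, u) \<in> G \<Longrightarrow> (x - y) \<bullet> u \<le> M * (1 + norm y)"
    using locally_bounded[OF assms] by metis
  define \<mu> where "\<mu> = (\<lambda>n. 1 / real (Suc n))"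
  have pos: "\<mu> n > 0" for n by (simp add: \<mu>_def)
  have "\<forall>n. \<exists>x u. (x, u) \<in> G \<and> x + \<mu> n *\<^sub>R u = w"
    using resolvent_exists pos by blast
  then obtain x u where G: "\<And>n. (x n, u n) \<in> G" and w: "\<And>n. x n + \<mu> n *\<^sub>R u n = w"
    by metis
  define K where "K = max M (2 * M * (1 + norm w) / \<epsilon>)"
  have "norm (u n) \<le> K" for n
  proof (cases "norm (u n) \<le> M")
    case True then show ?thesis by (simp add: K_def)
  next
    case False
    define a where "a = norm (u n)"
    have a: "a > M" "a > 0" using False M by (auto simp: a_def)
    have aa: "u n \<bullet> u n = a * a" by (simp add: a_def flip: power2_norm_eq_inner power2_eq_square)
    have x: "x n = w - \<mu> n *\<^sub>R u n" using w[of n] by (simp add: algebra_simps)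
    \<comment> \<open>The test point lies at distance \<open>\<epsilon> / 2\<close> from
      \<open>w\<close> in the direction of \<open>u n\<close>.\<close>
    have "w + (\<epsilon> / (2 * a)) *\<^sub>R u n \<in> ball w \<epsilon>"
      using a \<epsilon> by (simp add: dist_norm flip: a_def)
    from bd[OF this G[of n]] have "(\<epsilon> / 2) * a + \<mu> n * (a * a) \<le> M * (1 + norm (x n))"
      using a by (simp add: x inner_simps aa)
    also have "\<dots> \<le> M * (1 + (norm w + \<mu> n * a))"
      using M pos[of n] norm_triangle_ineq4[of w "\<mu> n *\<^sub>R u n"]
      by (intro mult_left_mono) (auto simp: x a_def)
    also have "\<dots> = M * (1 + norm w) + M * (\<mu> n * a)" by (simp add: algebra_simps)
    \<comment> \<open>Since \<open>M < a\<close>, this term is absorbed by the quadratic term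
      \<open>\<mu> n * (a * a)\<close> on the left.\<close>
    also have "M * (\<mu> n * a) \<le> a * (\<mu> n * a)"
      using a pos[of n] by (intro mult_right_mono) auto
    finally have "(\<epsilon> / 2) * a \<le> M * (1 + norm w)" by (simp add: mult.left_commute)
    then have "a \<le> 2 * M * (1 + norm w) / \<epsilon>" using \<epsilon> by (simp add: field_simps)
    then show ?thesis by (simp add: K_def a_def)
  qed
  moreover have "decseq \<mu>" by (auto simp: decseq_def \<mu>_def field_simps)
  moreover have "\<mu> \<longlonglongrightarrow> 0"
    using LIMSEQ_inverse_real_of_nat by (simp add: \<mu>_def inverse_eq_divide)
  ultimately show ?thesis using bounded_yosida_imp_mem_domain G w pos by blast
qed

text \<open>The convex set \<open>C\<close> contains \<open>x\<close> and a ball around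
  \<open>z\<close>, hence the image of that ball under contraction towards \<open>x\<close> by the
  factor \<open>t\<close>. So the point is interior to \<open>C\<close>, and
  \<open>interior C\<close> is an open subset of the domain.\<close>

lemma segment_to_interior_domain:
  assumes x: "x \<in> fst ` G" and z: "z \<in> interior (fst ` G)" and t: "0 < t" "t \<le> 1"
  shows "(1 - t) *\<^sub>R x + t *\<^sub>R z \<in> interior (fst ` G)"
proof -
  define C where "C = fst ` fst ` E"
  have "convex C"
    unfolding C_def using convex_E by (intro convex_linear_image linear_fst)
  have sub: "fst ` G \<subseteq> C"
    unfolding C_def using graph_in_E by force
  obtain e where e: "e > 0" "ball z e \<subseteq> C"
    using z sub by (meson mem_interior subset_trans)
  have "ball ((1 - t) *\<^sub>R x + t *\<^sub>R z) (t * e) \<subseteq> C"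
  proof
    fix y assume y: "y \<in> ball ((1 - t) *\<^sub>R x + t *\<^sub>R z) (t * e)"
    define d where "d = (1 / t) *\<^sub>R (y - (1 - t) *\<^sub>R x)"
    have "z - d = (1 / t) *\<^sub>R ((1 - t) *\<^sub>R x + t *\<^sub>R z - y)"
      using t by (simp add: d_def algebra_simps)
    then have "norm (z - d) < e"
      using y t by (simp add: dist_norm pos_divide_less_eq mult.commute)
    then have "d \<in> C" using e by (auto simp: dist_norm)
    then have "(1 - t) *\<^sub>R x + t *\<^sub>R d \<in> C"
      using \<open>convex C\<close> sub x t by (auto simp: convex_alt)
    then show "y \<in> C" using t by (simp add: d_def)
  qed
  then have "(1 - t) *\<^sub>R x + t *\<^sub>R z \<in> interior C"
    using e t by (auto simp: mem_interior intro!: exI[of _ "t * e"])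
  moreover have "interior C \<subseteq> fst ` G"
    unfolding C_def using interior_domain_representative by blast
  ultimately show ?thesis using interior_maximal open_interior by blast
qed

end

section \<open>Maximally monotone operators with extended-real representatives\<close>

lemma fst_op_graph: "fst ` op_graph A = op_dom A"
  by (force simp: op_graph_def op_dom_def)

text \<open>Adjoining \<open>v\<close> to the values at \<open>x\<close> preserves monotonicity, so
  by maximality the graph does not grow.\<close>

lemma maximally_monotoneD:
  assumes "maximally_monotone S"
    and mon: "\<And>y u. (y, u) \<in> op_graph S \<Longrightarrow> 0 \<le> (x - y) \<bullet> (v - u)"
  shows "(x, v) \<in> op_graph S"
proof -
  define B where "B = (\<lambda>y. if y = x then insert v (S x) else S y)"
  have B: "op_graph B = insert (x, v) (op_graph S)"
    by (auto simp: B_def op_graph_def split: if_splits)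
  have "0 \<le> (y - x) \<bullet> (u - v)" if "(y, u) \<in> op_graph S" for y u
    using mon[OF that] by (simp add: inner_simps)
  then have "monotone_op B"
    using assms unfolding monotone_op_def maximally_monotone_def B by auto
  then have "op_graph B = op_graph S"
    using assms(1) B unfolding maximally_monotone_def by blast
  then show ?thesis using B by blast
qed

lemma represented_operatorI:
  fixes S :: "'a::{real_inner, complete_space} \<Rightarrow> 'a set"
  assumes S: "maximally_monotone S" and h: "h \<in> representatives S"
  shows "represented_operator (op_graph S) {(p, r). h p \<le> ereal r}"
proof
  show "0 \<le> (x - y) \<bullet> (u - v)" if "(x, u) \<in> op_graph S" "(y, v) \<in> op_graph S" for x u y v
    using S that unfolding maximally_monotone_def monotone_op_def by fast
  show "(x, v) \<in> op_graph S"
    if "\<And>y u. (y, u) \<in> op_graph S \<Longrightarrow> 0 \<le> (x - y) \<bullet> (v - u)" for x v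
    using S that by (rule maximally_monotoneD)
  show "closed {(p, r). h p \<le> ereal r}"
    using h by (intro closed_epigraph lsc_fun_norm_weak_imp_norm) (simp add: representatives_def)
  show "convex {(p, r). h p \<le> ereal r}"
    using h by (intro convex_epigraph) (simp add: representatives_def)
  show "x \<bullet> v \<le> r" if "((x, v), r) \<in> {(p, r). h p \<le> ereal r}" for x v r
  proof -
    have "ereal (x \<bullet> v) \<le> h (x, v)" using h by (simp add: representatives_def)
    also have "\<dots> \<le> ereal r" using that by simp
    finally show ?thesis by simp
  qed
  show "((x, v), x \<bullet> v) \<in> {(p, r). h p \<le> ereal r}" if "(x, v) \<in> op_graph S" for x v
  proof -
    have "h (x, v) = ereal (x \<bullet> v)" using h that unfolding representatives_def by blast
    then show ?thesis by simp
  qed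
qed

lemma segment_to_interior_op_dom:
  fixes S :: "'a::{real_inner, complete_space} \<Rightarrow> 'a set"
  assumes "maximally_monotone S" "h \<in> representatives S"
    and "x \<in> op_dom S" "z \<in> interior (op_dom S)" "0 < t" "t \<le> 1"
  shows "(1 - t) *\<^sub>R x + t *\<^sub>R z \<in> interior (op_dom S)"
  using represented_operator.segment_to_interior_domain[OF represented_operatorI[OF assms(1,2)]] assms(3-)
  by (simp add: fst_op_graph)

lemma bregman_dist_nonneg:
  assumes "h \<in> representatives S"
  shows "0 \<le> bregman_dist S T h x y"
proof -
  have "0 \<le> h (x, v) - ereal (x \<bullet> v)" for v
    using assms by (intro ereal_diff_positive) (simp add: representatives_def)
  then show ?thesis
    by (simp add: bregman_dist_def INF_greatest)
qed

section \<open>Bounds for convex functions\<close>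

lemma convex_fun_segment_le:
  assumes "convex_fun \<theta>" "\<theta> x \<le> ereal a" "\<theta> z \<le> ereal b" "0 < t" "t < 1"
  shows "\<theta> ((1 - t) *\<^sub>R x + t *\<^sub>R z) \<le> ereal ((1 - t) * a + t * b)"
proof -
  have "\<theta> ((1 - t) *\<^sub>R x + t *\<^sub>R z) \<le> ereal (1 - t) * \<theta> x + ereal t * \<theta> z"
    using assms by (simp add: convex_fun_def)
  also have "\<dots> \<le> ereal (1 - t) * ereal a + ereal t * ereal b"
    using assms by (intro add_mono ereal_mult_left_mono) auto
  finally show ?thesis by simp
qed

lemma fun_dom_eq_ereal:
  assumes "proper_fun \<theta>" "x \<in> fun_dom \<theta>"
  obtains a where "\<theta> x = ereal a"
  using assms by (cases "\<theta> x") (auto simp: proper_fun_def not_minus_infinity_def fun_dom_def)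

text \<open>Convexity bounds \<open>m\<close> by the chord between the values at \<open>x\<close>
  and \<open>z\<close>, which tends to the value at \<open>x\<close> as \<open>t\<close> decreases
  to 0; outside the domain the value is infinite.\<close>

lemma bound_extends_along_segments:
  fixes \<theta> :: "'a::real_normed_vector \<Rightarrow> ereal"
  assumes \<theta>: "proper_fun \<theta>" "convex_fun \<theta>"
    and seg: "\<And>t. 0 < t \<Longrightarrow> t < 1 \<Longrightarrow> (1 - t) *\<^sub>R x + t *\<^sub>R z \<in> U"
    and z: "z \<in> fun_dom \<theta>"
    and bound: "\<And>u. u \<in> U \<Longrightarrow> ereal m \<le> \<theta> u"
  shows "ereal m \<le> \<theta> x"
proof (cases "x \<in> fun_dom \<theta>")
  case True
  then obtain a b where ab: "\<theta> x = ereal a" "\<theta> z = ereal b"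
    using fun_dom_eq_ereal[OF \<theta>(1)] z by metis
  have "m \<le> (1 - t) * a + t * b" if "0 < t" "t < 1" for t
    using order_trans[OF bound[OF seg[OF that]] convex_fun_segment_le[OF \<theta>(2) _ _ that]] ab
    by (metis ereal_less_eq(3) order_refl)
  then have "\<forall>\<^sub>F t in at_right 0. m \<le> (1 - t) * a + t * b"
    using eventually_at_right_real[of 0 1] by (auto elim: eventually_mono)
  moreover have "((\<lambda>t. (1 - t) * a + t * b) \<longlongrightarrow> a) (at_right 0)"
    by (rule tendsto_eq_intros refl | simp)+
  ultimately have "m \<le> a" by (intro tendsto_lowerbound) auto
  then show ?thesis using ab by simp
qed (simp add: fun_dom_def)

text \<open>The domain is convex, so the open segment stays in both sets; the norm bound passes to
  the endpoint \<open>x\<close> by continuity.\<close>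

lemma norm_bound_extends_along_segments:
  fixes \<theta> :: "'a::real_normed_vector \<Rightarrow> ereal"
  assumes \<theta>: "proper_fun \<theta>" "convex_fun \<theta>"
    and seg: "\<And>t. 0 < t \<Longrightarrow> t < 1 \<Longrightarrow> (1 - t) *\<^sub>R x + t *\<^sub>R z \<in> U"
    and xz: "x \<in> fun_dom \<theta>" "z \<in> fun_dom \<theta>"
    and bound: "\<And>u. u \<in> U \<inter> fun_dom \<theta> \<Longrightarrow> norm u \<le> B"
  shows "norm x \<le> B"
proof -
  obtain a b where ab: "\<theta> x = ereal a" "\<theta> z = ereal b"
    using fun_dom_eq_ereal[OF \<theta>(1)] xz by metis
  have "norm ((1 - t) *\<^sub>R x + t *\<^sub>R z) \<le> B" if "0 < t" "t < 1" for t
  proof (intro bound IntI seg that)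
    have "\<theta> ((1 - t) *\<^sub>R x + t *\<^sub>R z) \<le> ereal ((1 - t) * a + t * b)"
      using ab that by (intro convex_fun_segment_le \<theta>(2)) auto
    then show "(1 - t) *\<^sub>R x + t *\<^sub>R z \<in> fun_dom \<theta>"
      by (auto simp: fun_dom_def)
  qed
  then have "\<forall>\<^sub>F t in at_right 0. norm ((1 - t) *\<^sub>R x + t *\<^sub>R z) \<le> B"
    using eventually_at_right_real[of 0 1] by (auto elim: eventually_mono)
  moreover have "((\<lambda>t. norm ((1 - t) *\<^sub>R x + t *\<^sub>R z)) \<longlongrightarrow> norm x) (at_right 0)"
    by (rule tendsto_eq_intros refl | simp)+
  ultimately show ?thesis by (intro tendsto_upperbound) auto
qed

text \<open>Lower semicontinuity at a point \<open>z\<close> of the domain gives the bound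
  \<open>b - 1\<close> on a ball of radius \<open>r\<close>. Convexity propagates it outwards along
  rays from \<open>z\<close> with slope at most \<open>2 / r\<close>.\<close>

lemma convex_lsc_linear_lower_bound:
  fixes \<theta> :: "'a::real_normed_vector \<Rightarrow> ereal"
  assumes \<theta>: "proper_fun \<theta>" "lsc_fun euclidean \<theta>" "convex_fun \<theta>"
  obtains c where "c \<ge> 0" "\<And>x. ereal (- c * (1 + norm x)) \<le> \<theta> x"
proof -
  obtain z where z: "z \<in> fun_dom \<theta>" using \<theta>(1) by (auto simp: proper_fun_def)
  then obtain b where b: "\<theta> z = ereal b" using fun_dom_eq_ereal[OF \<theta>(1)] by metis
  have "open {x. ereal (b - 1) < \<theta> x}"
    using \<theta>(2) by (simp add: lsc_fun_def)
  moreover have "z \<in> {x. ereal (b - 1) < \<theta> x}" by (simp add: b)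
  ultimately obtain r where r: "r > 0" "ball z r \<subseteq> {x. ereal (b - 1) < \<theta> x}"
    using openE by blast
  define c where "c = \<bar>b\<bar> + 1 + 2 / r * (1 + norm z)"
  have c: "c \<ge> \<bar>b\<bar> + 1" "c \<ge> 2 / r" "c \<ge> 0"
    using r by (auto simp: c_def add_nonneg_nonneg distrib_left)
  have main: "ereal (- c * (1 + norm x)) \<le> \<theta> x" for x
  proof (cases "x \<in> fun_dom \<theta>")
    case True
    then obtain a where a: "\<theta> x = ereal a" using fun_dom_eq_ereal[OF \<theta>(1)] by metis
    have "b - 1 - 2 / r * norm (x - z) \<le> a"
    proof (cases "x \<in> ball z r")
      case True
      then have "b - 1 < a" using r a by auto
      moreover have "0 \<le> 2 / r * norm (x - z)" using r by simp
      ultimately show ?thesis by linarith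
    next
      case False
      define d where "d = norm (x - z)"
      \<comment> \<open>This \<open>t\<close> places the intermediate point at distance
        \<open>r / 2\<close> from \<open>z\<close>, inside the ball.\<close>
      define t where "t = r / (2 * d)"
      have d: "r \<le> d" "0 < d" using False r by (auto simp: d_def dist_norm norm_minus_commute)
      then have t: "0 < t" "t < 1" "t * d = r / 2" using r by (auto simp: t_def)
      have "(1 - t) *\<^sub>R z + t *\<^sub>R x = z + t *\<^sub>R (x - z)" by (simp add: algebra_simps)
      then have "(1 - t) *\<^sub>R z + t *\<^sub>R x \<in> ball z r"
        using t r by (simp add: dist_norm flip: d_def)
      then have "ereal (b - 1) < \<theta> ((1 - t) *\<^sub>R z + t *\<^sub>R x)" using r by blast
      also have "\<dots> \<le> ereal ((1 - t) * b + t * a)"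
        using a b t by (intro convex_fun_segment_le \<theta>(3)) auto
      finally have "t * b - 1 < t * a" by (simp add: algebra_simps)
      then have "b - 1 / t < a" using t by (simp add: field_simps)
      moreover have "1 / t = 2 / r * d" using r d by (simp add: t_def)
      ultimately show ?thesis by (simp add: d_def)
    qed
    moreover have "2 / r * norm (x - z) \<le> 2 / r * (norm x + norm z)"
      using r norm_triangle_ineq4 by (intro mult_left_mono) auto
    moreover have "2 / r * norm x \<le> c * norm x"
      using c by (intro mult_right_mono) auto
    moreover have "c * (1 + norm x) = c + c * norm x" "2 / r * (norm x + norm z) = 2 / r * norm x + 2 / r * norm z"
      "c = \<bar>b\<bar> + 1 + 2 / r + 2 / r * norm z"
      by (auto simp: distrib_left c_def)
    moreover have "2 / r > 0" using r by simp
    ultimately have "- c * (1 + norm x) \<le> a" by linarith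
    then show ?thesis by (simp add: a)
  qed (simp add: fun_dom_def)
  show ?thesis by (rule that[OF c(3) main])
qed

section \<open>Coercivity of the sum in the three cases\<close>

theorem proposition4p14:
  fixes S T :: "'a::{real_inner, complete_space} \<Rightarrow> 'a set"
    and h :: "'a \<times> 'a \<Rightarrow> ereal"
    and \<theta> :: "'a \<Rightarrow> ereal"
    and \<gamma> :: real
    and U\<^sub>S U\<^sub>T :: "'a set"
  defines "U\<^sub>S \<equiv> interior (op_dom S)"
    and "U\<^sub>T \<equiv> interior (op_dom T)"
  assumes "maximally_monotone S"
    and "h \<in> representatives S"
    and "proper_fun \<theta>"
    and "lsc_fun euclidean \<theta>"
    and "convex_fun \<theta>"
    and "U\<^sub>S \<inter> fun_dom \<theta> \<noteq> {}"
    and "\<gamma> > 0"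
    and "(bounded (U\<^sub>S \<inter> fun_dom \<theta>) \<and> (\<forall>y\<in>U\<^sub>T. coercive (\<lambda>x. bregman_dist S T h x y)))
       \<or> ((INF x\<in>U\<^sub>S. \<theta> x) > - \<infinity> \<and> (\<forall>y\<in>U\<^sub>T. coercive (\<lambda>x. bregman_dist S T h x y)))
       \<or> (\<forall>y\<in>U\<^sub>T. supercoercive (\<lambda>x. bregman_dist S T h x y))"
  shows "\<forall>y\<in>U\<^sub>T. coercive (\<lambda>x. \<theta> x + ereal (1 / \<gamma>) * bregman_dist S T h x y)"
proof
  fix y assume y: "y \<in> U\<^sub>T"
  define D where "D = (\<lambda>x. bregman_dist S T h x y)"
  have D0: "0 \<le> D x" for x
    using bregman_dist_nonneg assms(4) by (simp add: D_def)
  have D_top: "D x = \<infinity>" if "x \<notin> op_dom S" for x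
    using that by (simp add: D_def bregman_dist_def)
  have \<theta>: "\<theta> x \<noteq> - \<infinity>" for x
    using assms(5) by (simp add: proper_fun_def not_minus_infinity_def)
  obtain z where z: "z \<in> interior (op_dom S)" "z \<in> fun_dom \<theta>"
    using assms(8) by (auto simp: U\<^sub>S_def)
  have seg: "(1 - t) *\<^sub>R x + t *\<^sub>R z \<in> U\<^sub>S" if "x \<in> op_dom S" "0 < t" "t < 1" for x t
    unfolding U\<^sub>S_def using that z by (intro segment_to_interior_op_dom[OF assms(3,4)]) auto
  \<comment> \<open>The threshold solves \<open>m + D x / \<gamma> > r\<close> for
    \<open>D x\<close>.\<close>
  have sum_gt: "ereal r < \<theta> x + ereal (1 / \<gamma>) * D x"
    if "ereal m \<le> \<theta> x" "ereal (\<gamma> * (r - m)) < D x" for r m x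
  proof (cases "D x")
    case (real d)
    then have "ereal r < ereal m + ereal (1 / \<gamma>) * D x"
      using that assms(9) by (simp add: field_simps)
    also have "\<dots> \<le> \<theta> x + ereal (1 / \<gamma>) * D x"
      using that by (intro add_right_mono)
    finally show ?thesis .
  qed (use \<open>\<gamma> > 0\<close> \<theta> D0[of x] in auto)
  have sum_top: "\<theta> x + ereal (1 / \<gamma>) * D x = \<infinity>" if "x \<notin> op_dom S \<or> x \<notin> fun_dom \<theta>" for x
    using that D_top[of x] D0[of x] \<theta>[of x] \<open>\<gamma> > 0\<close> by (cases "D x") (auto simp: fun_dom_def)
  have "\<forall>\<^sub>F x in at_infinity. ereal r < \<theta> x + ereal (1 / \<gamma>) * D x" for r
    using assms(10)
  proof (elim disjE conjE)
    assume "bounded (U\<^sub>S \<inter> fun_dom \<theta>)"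
    then obtain B where B: "\<And>u. u \<in> U\<^sub>S \<inter> fun_dom \<theta> \<Longrightarrow> norm u \<le> B"
      unfolding bounded_iff by metis
    have "norm x \<le> B" if "x \<in> op_dom S" "x \<in> fun_dom \<theta>" for x
      by (rule norm_bound_extends_along_segments[OF assms(5,7) seg[OF that(1)] that(2) z(2) B])
    \<comment> \<open>Beyond radius \<open>B\<close> every point lies outside
      \<open>op_dom S\<close> or \<open>fun_dom \<theta>\<close>, where the sum is infinite.\<close>
    then have "ereal r < \<theta> x + ereal (1 / \<gamma>) * D x" if "B + 1 \<le> norm x" for x
      using that sum_top[of x] by fastforce
    then show ?thesis unfolding eventually_at_infinity by (intro exI[of _ "B + 1"]) auto
  next
    assume inf: "- \<infinity> < (INF x\<in>U\<^sub>S. \<theta> x)" and "\<forall>y\<in>U\<^sub>T. coercive (\<lambda>x. bregman_dist S T h x y)"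
    then have coe: "\<forall>\<^sub>F x in at_infinity. ereal s < D x" for s
      using y by (simp add: coercive_def tendsto_PInfty D_def)
    obtain m where "ereal m < (INF x\<in>U\<^sub>S. \<theta> x)"
      using ereal_dense2[OF inf] by metis
    then have "ereal m \<le> \<theta> u" if "u \<in> U\<^sub>S" for u
      using INF_lower[OF that, of \<theta>] by order
    then have "ereal m \<le> \<theta> x" if "x \<in> op_dom S" for x
      using bound_extends_along_segments[OF assms(5,7) seg[OF that] z(2)] by simp
    then have "ereal r < \<theta> x + ereal (1 / \<gamma>) * D x" if "ereal (\<gamma> * (r - m)) < D x" for x
      using that sum_gt sum_top[of x] by (cases "x \<in> op_dom S") auto
    then show ?thesis by (rule eventually_mono[OF coe])
  next
    assume "\<forall>y\<in>U\<^sub>T. supercoercive (\<lambda>x. bregman_dist S T h x y)"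
    then have sup: "\<forall>\<^sub>F x in at_infinity. ereal s < D x / ereal (norm x)" for s
      using y by (simp add: supercoercive_def tendsto_PInfty D_def)
    obtain c where c: "c \<ge> 0" "\<And>x. ereal (- c * (1 + norm x)) \<le> \<theta> x"
      using convex_lsc_linear_lower_bound[OF assms(5,6,7)] by metis
    \<comment> \<open>For \<open>norm x\<close> at least 1 and at least \<open>r\<close>, the
      quantity \<open>r + c * (1 + norm x)\<close> that \<open>D x / \<gamma>\<close> has to exceed
      is at most \<open>(2 * c + 1) * norm x\<close>.\<close>
    define s where "s = \<gamma> * (2 * c + 1)"
    have gt: "ereal r < \<theta> x + ereal (1 / \<gamma>) * D x"
      if x: "max 1 r \<le> norm x" and q: "ereal s < D x / ereal (norm x)" for x
    proof (rule sum_gt[OF c(2)])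
      have "c \<le> c * norm x"
        using mult_left_mono[of 1 "norm x" c] x c(1) by simp
      then have "r + c * (1 + norm x) \<le> (2 * c + 1) * norm x"
        using x by (simp add: algebra_simps)
      then have "\<gamma> * (r + c * (1 + norm x)) \<le> \<gamma> * ((2 * c + 1) * norm x)"
        using \<open>\<gamma> > 0\<close> by (intro mult_left_mono) auto
      then have "ereal (\<gamma> * (r - - c * (1 + norm x))) \<le> ereal (s * norm x)"
        by (simp add: s_def mult.assoc)
      also have "\<dots> < D x"
      proof (cases "D x")
        case (real d)
        moreover have "0 < norm x" using x by linarith
        ultimately show ?thesis using q by (simp add: pos_less_divide_eq)
      qed (use D0[of x] in auto)
      finally show "ereal (\<gamma> * (r - - c * (1 + norm x))) < D x" .
    qed
    have "\<forall>\<^sub>F x in at_infinity. max 1 r \<le> norm (x :: 'a)"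
      unfolding eventually_at_infinity by (rule exI, intro allI impI)
    then show ?thesis using sup[of s] by eventually_elim (rule gt)
  qed
  then show "coercive (\<lambda>x. \<theta> x + ereal (1 / \<gamma>) * bregman_dist S T h x y)"
    by (simp add: coercive_def tendsto_PInfty D_def)
qed

end
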